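(* Fix an integer $n \ge 2$. For a positive integer $r$, let $m(n,r)$ denote the minimal number of edges in an $n$-uniform hypergraph whose chromatic number is greater than $r$. Then the sequence $a_r := m(n,r)/r^n$ ($r = 1,2,\dots$) has a limit as $r \to \infty$.
   Context: A hypergraph $H=(V,E)$ consists of a finite vertex set $V$ and a family $E$ of subsets of $V$ (edges); it is $n$-uniform if every edge has exactly $n$ elements. An $r$-coloring is a map $V\to\{1,\dots,r\}$; it is proper if no edge is monochromatic (every edge contains two vertices of different colors). The chromatic number $\chi(H)$ is the least $r$ for which a proper $r$-coloring exists. *)

theory Defs
  imports Complex_Main "HOL-Library.FuncSet"
begin

definition hypergraph :: "'a set \<Rightarrow> 'a set set \<Rightarrow> bool" where
  "hypergraph V E \<longleftrightarrow> finite V \<and> E \<subseteq> Pow V"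

definition uniform :: "nat \<Rightarrow> 'a set set \<Rightarrow> bool" where
  "uniform n E \<longleftrightarrow> (\<forall>e\<in>E. card e = n)"

definition coloring :: "'a set \<Rightarrow> nat \<Rightarrow> ('a \<Rightarrow> nat) \<Rightarrow> bool" where
  "coloring V r f \<longleftrightarrow> f \<in> V \<rightarrow> {1..r}"

definition proper :: "'a set set \<Rightarrow> ('a \<Rightarrow> nat) \<Rightarrow> bool" where
  "proper E f \<longleftrightarrow> (\<forall>e\<in>E. \<exists>x\<in>e. \<exists>y\<in>e. f x \<noteq> f y)"

text \<open>
  Meaningful when every edge has at least two elements: then an injective coloring
  is proper, so the least number exists. With an edge of size at most one there is
  no proper coloring at all.
\<close>

definition chromatic_number :: "'a set \<Rightarrow> 'a set set \<Rightarrow> nat" where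
  "chromatic_number V E = (LEAST r. \<exists>f. coloring V r f \<and> proper E f)"

text \<open>
  Vertices are taken in \<^typ>\<open>nat\<close>; since vertex sets are finite, every hypergraph
  is isomorphic to one of this kind. For \<open>n \<ge> 2\<close> the least number exists, witnessed by
  all \<open>n\<close>-subsets of a set of \<open>r * (n - 1) + 1\<close> vertices.
\<close>

definition m :: "nat \<Rightarrow> nat \<Rightarrow> nat" where
  "m n r = (LEAST k. \<exists>(V :: nat set) E.
     hypergraph V E \<and> uniform n E \<and> chromatic_number V E > r \<and> card E = k)"

end

theory Submission
  imports Defs
begin

text \<open>
  Let \<open>f N\<close> be the largest chromatic number of an \<open>n\<close>-uniform hypergraph with at most \<open>N\<close>
  edges, so that \<open>N < m n r\<close> iff \<open>f N \<le> r\<close>. Partitioning the vertices at random into \<open>k\<close> parts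
  leaves on average at most \<open>N / k ^ (n - 1)\<close> edges inside parts; coloring the parts with disjoint
  palettes gives \<open>f N \<le> f a\<^sub>1 + \<dots> + f a\<^sub>k\<close> for some \<open>a\<^sub>1 + \<dots> + a\<^sub>k \<le> N / k ^ (n - 1)\<close>.

  Let \<open>u\<close> be the limit superior of \<open>f N / N powr (1 / n)\<close>, and suppose this ratio is well below
  \<open>u\<close> at some large \<open>x\<close>. Take a much larger \<open>N\<close> at which it is close to \<open>u\<close>, and \<open>k\<close> such that
  \<open>N / k ^ n\<close> is slightly below \<open>x\<close>. By strict concavity of the \<open>n\<close>-th root, the splitting
  inequality forces most \<open>a\<^sub>i\<close> to be close to \<open>N / k ^ n\<close>, hence at most \<open>x\<close>; but there
  monotonicity makes \<open>f\<close> too small. So \<open>f N / N powr (1 / n)\<close> converges; its limit is positive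
  by the complete hypergraphs, and inverting \<open>f\<close> gives the limit of \<open>m n r / r ^ n\<close>.
\<close>

section \<open>Colorability and its extremal function\<close>

definition colorable :: "'a set \<Rightarrow> 'a set set \<Rightarrow> nat \<Rightarrow> bool" where
  "colorable V E r \<longleftrightarrow> (\<exists>f. coloring V r f \<and> proper E f)"

text \<open>The \<open>f\<close> of the overview, encoded as a least uniform bound rather than a
  maximum over infinitely many hypergraphs; for \<open>n \<ge> 2\<close> some bound exists by
  \<open>max_chromatic_exists\<close>.\<close>

definition max_chromatic :: "nat \<Rightarrow> nat \<Rightarrow> nat" where
  "max_chromatic n N = (LEAST r. \<forall>(V :: nat set) E.
     hypergraph V E \<and> uniform n E \<and> card E \<le> N \<longrightarrow> colorable V E r)"

lemma colorable_mono:
  assumes "colorable V E r" "r \<le> s"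
  shows "colorable V E s"
proof -
  have "{1..r} \<subseteq> {1..s}" using assms(2) by auto
  then show ?thesis using assms(1) unfolding colorable_def coloring_def by blast
qed

text \<open>One vertex \<open>p e\<close> is picked from each edge; picked vertices get distinct
  colors from 2 on, all others get 1. Every edge contains \<open>p e\<close> and a second vertex,
  whose color differs.\<close>

lemma colorable_Suc_card_edges:
  assumes "hypergraph V E" "uniform n E" "n \<ge> 2"
  shows "colorable V E (Suc (card E))"
proof -
  have fE: "finite E" using assms(1) unfolding hypergraph_def
    by (meson finite_Pow_iff finite_subset)
  have ce: "card e \<ge> 2" if "e \<in> E" for e using assms that by (auto simp: uniform_def)
  have ne: "\<exists>x. x \<in> e" if "e \<in> E" for e using ce[OF that] by (cases "e = {}") auto
  define p where "p e = (SOME x. x \<in> e)" for e :: "'a set"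
  have p: "p e \<in> e" if "e \<in> E" for e using ne[OF that] unfolding p_def by (rule someI_ex)
  define S where "S = p ` E"
  have fS: "finite S" and cS: "card S \<le> card E" using fE by (auto simp: S_def card_image_le)
  obtain h where h: "bij_betw h S {0..<card S}" using ex_bij_betw_finite_nat[OF fS] by blast
  define c where "c x = (if x \<in> S then h x + 2 else 1)" for x
  have hl: "h x < card S" if "x \<in> S" for x using h that by (auto simp: bij_betw_def)
  have "coloring V (Suc (card E)) c"
    unfolding coloring_def c_def using hl cS by fastforce
  moreover have "proper E c"
    unfolding proper_def
  proof
    fix e assume e: "e \<in> E"
    have "\<not> e \<subseteq> {p e}" using ce[OF e] card_mono[of "{p e}" e] by auto
    then obtain y where y: "y \<in> e" "y \<noteq> p e" by auto
    have pS: "p e \<in> S" using e by (auto simp: S_def)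
    have "c (p e) \<noteq> c y"
    proof (cases "y \<in> S")
      case True
      then have "h (p e) \<noteq> h y" using h pS y unfolding bij_betw_def inj_on_def by blast
      then show ?thesis using pS True by (simp add: c_def)
    qed (use pS in \<open>simp add: c_def\<close>)
    then show "\<exists>x\<in>e. \<exists>y\<in>e. c x \<noteq> c y" using p[OF e] y by blast
  qed
  ultimately show ?thesis unfolding colorable_def by blast
qed

lemma chromatic_number_gt_iff:
  assumes "hypergraph V E" "uniform n E" "n \<ge> 2"
  shows "chromatic_number V E > r \<longleftrightarrow> \<not> colorable V E r"
proof -
  have eq: "chromatic_number V E = (LEAST r. colorable V E r)"
    unfolding chromatic_number_def colorable_def ..
  have "colorable V E (chromatic_number V E)"
    unfolding eq by (rule LeastI, rule colorable_Suc_card_edges[OF assms])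
  then show ?thesis
    by (metis colorable_mono eq leI not_less_Least)
qed

lemma max_chromatic_exists:
  fixes n N :: nat
  assumes "n \<ge> 2"
  shows "\<forall>(V :: nat set) E. hypergraph V E \<and> uniform n E \<and> card E \<le> N \<longrightarrow> colorable V E (Suc N)"
  using colorable_Suc_card_edges[OF _ _ assms] colorable_mono Suc_le_mono by blast

lemma colorable_max_chromatic:
  fixes V :: "nat set"
  assumes "n \<ge> 2" "hypergraph V E" "uniform n E" "card E \<le> N"
  shows "colorable V E (max_chromatic n N)"
  using LeastI[where P="\<lambda>r. \<forall>(V :: nat set) E.
     hypergraph V E \<and> uniform n E \<and> card E \<le> N \<longrightarrow> colorable V E r", OF max_chromatic_exists[OF assms(1)]]
    assms(2-) unfolding max_chromatic_def by blast

lemma max_chromatic_le: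
  assumes "\<And>(V :: nat set) E. hypergraph V E \<Longrightarrow> uniform n E \<Longrightarrow> card E \<le> N \<Longrightarrow> colorable V E r"
  shows "max_chromatic n N \<le> r"
  unfolding max_chromatic_def by (rule Least_le) (use assms in blast)

lemma max_chromatic_le_Suc: "n \<ge> 2 \<Longrightarrow> max_chromatic n N \<le> Suc N"
  using max_chromatic_exists by (intro max_chromatic_le) blast

lemma max_chromatic_mono:
  assumes "n \<ge> 2" "N \<le> N'"
  shows "max_chromatic n N \<le> max_chromatic n N'"
  using assms by (intro max_chromatic_le colorable_max_chromatic) auto

section \<open>Complete hypergraphs, and \<open>m\<close> as an inverse of
  \<open>max_chromatic\<close>\<close>

text \<open>Pigeonhole: \<open>r * n + 1\<close> vertices do not fit into \<open>r\<close> color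
  classes with fewer than \<open>n\<close> vertices each, and a class with at least \<open>n\<close>
  vertices contains an edge.\<close>

lemma complete_not_colorable:
  "\<not> colorable {..r * n} {e. e \<subseteq> {..r * n} \<and> card e = n} r"
proof
  let ?V = "{..r * n}"
  assume "colorable ?V {e. e \<subseteq> ?V \<and> card e = n} r"
  then obtain c where c: "c \<in> ?V \<rightarrow> {1..r}" "proper {e. e \<subseteq> ?V \<and> card e = n} c"
    unfolding colorable_def coloring_def by blast
  have "card {x \<in> ?V. c x = i} < n" for i
  proof (rule ccontr)
    assume "\<not> card {x \<in> ?V. c x = i} < n"
    then obtain e where e: "e \<subseteq> {x \<in> ?V. c x = i}" "card e = n"
      by (meson not_less obtain_subset_with_card_n)
    then have "\<exists>x\<in>e. \<exists>y\<in>e. c x \<noteq> c y" using c(2) unfolding proper_def by blast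
    then show False using e by auto
  qed
  then have "(\<Sum>i\<in>{1..r}. card {x \<in> ?V. c x = i}) \<le> (\<Sum>i\<in>{1..r}. n)"
    by (intro sum_mono less_imp_le)
  moreover have "card ?V = (\<Sum>i\<in>{1..r}. card {x \<in> ?V. c x = i})"
  proof -
    have "c ` ?V \<subseteq> {1..r}" using c(1) by blast
    then show ?thesis using sum.group[of ?V "{1..r}" c "\<lambda>_. 1::nat"] by simp
  qed
  ultimately show False by simp
qed

lemma m_witness_complete:
  fixes n r :: nat
  assumes "n \<ge> 2"
  shows "\<exists>(V :: nat set) E. hypergraph V E \<and> uniform n E \<and> chromatic_number V E > r
           \<and> card E = Suc (r * n) choose n"
proof (intro exI conjI)
  let ?V = "{..r * n}" and ?E = "{e. e \<subseteq> {..r * n} \<and> card e = n}"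
  show h: "hypergraph ?V ?E" "uniform n ?E" by (auto simp: hypergraph_def uniform_def)
  show "chromatic_number ?V ?E > r"
    using chromatic_number_gt_iff[OF h assms] complete_not_colorable by auto
  show "card ?E = Suc (r * n) choose n" using n_subsets[of ?V n] by simp
qed

text \<open>Complete hypergraphs already have the right order \<open>r ^ n\<close>; the crude
  constant suffices to show later that the limit \<open>L\<close> is positive.\<close>

lemma m_le:
  assumes "n \<ge> 2" "r \<ge> 1"
  shows "m n r \<le> (r * Suc n) ^ n"
proof -
  have "m n r \<le> Suc (r * n) choose n"
    unfolding m_def by (rule Least_le) (rule m_witness_complete[OF assms(1)])
  also have "\<dots> \<le> Suc (r * n) ^ n"
    by (cases "n \<le> Suc (r * n)") (simp_all add: binomial_le_pow binomial_eq_0)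
  also have "\<dots> \<le> (r * Suc n) ^ n" using assms by (intro power_mono) auto
  finally show ?thesis .
qed

text \<open>Forwards, a hypergraph with at most \<open>N\<close> edges that is not
  \<open>r\<close>-colorable would contradict the minimality of \<open>m n r\<close>. Backwards, a
  hypergraph attaining \<open>m n r\<close> is not \<open>r\<close>-colorable, so it has more than
  \<open>N\<close> edges.\<close>

lemma less_m_iff:
  assumes "n \<ge> 2"
  shows "N < m n r \<longleftrightarrow> max_chromatic n N \<le> r"
proof
  assume N: "N < m n r"
  show "max_chromatic n N \<le> r"
  proof (rule max_chromatic_le)
    fix V :: "nat set" and E
    assume h: "hypergraph V E" "uniform n E" and "card E \<le> N"
    then have "card E < m n r" using N by simp
    then have "\<not> chromatic_number V E > r"
      unfolding m_def using not_less_Least h by blast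
    then show "colorable V E r" using chromatic_number_gt_iff[OF h assms] by blast
  qed
next
  assume r: "max_chromatic n N \<le> r"
  have "\<exists>(V :: nat set) E. hypergraph V E \<and> uniform n E \<and> chromatic_number V E > r \<and> card E = m n r"
    unfolding m_def by (rule LeastI_ex) (use m_witness_complete[OF assms] in blast)
  then obtain V :: "nat set" and E where h: "hypergraph V E" "uniform n E"
    and c: "chromatic_number V E > r" "card E = m n r" by blast
  have "\<not> card E \<le> N"
    using colorable_mono[OF colorable_max_chromatic[OF assms h] r] c chromatic_number_gt_iff[OF h assms]
    by blast
  then show "N < m n r" using c by simp
qed

section \<open>Random partitions, the splitting inequality and the order of growth\<close>

text \<open>First moment: a uniformly random \<open>g\<close> takes the constant value
  \<open>i\<close> on a given edge with probability \<open>1 / k ^ n\<close>. Summing over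
  \<open>i\<close> and the edges gives the mean \<open>card E / k ^ (n - 1)\<close>, and some
  \<open>g\<close> does no worse.\<close>

lemma exists_partition_few_monochromatic:
  fixes V :: "'a set"
  assumes "hypergraph V E" "uniform n E" "n \<ge> 1" "k \<ge> 1"
  shows "\<exists>g \<in> V \<rightarrow> {..<k}. (\<Sum>i<k. card {e \<in> E. \<forall>x\<in>e. g x = i}) * k ^ (n - 1) \<le> card E"
proof (rule ccontr)
  assume neg: "\<not> ?thesis"
  \<comment> \<open>Extensional maps make the sample space finite.\<close>
  let ?G = "V \<rightarrow>\<^sub>E {..<k}"
  let ?M = "\<lambda>g. \<Sum>i<k. card {e \<in> E. \<forall>x\<in>e. g x = i}"
  have fV: "finite V" and EV: "E \<subseteq> Pow V" using assms(1) by (auto simp: hypergraph_def)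
  have fE: "finite E" using fV EV by (meson finite_Pow_iff finite_subset)
  have fG: "finite ?G" using fV by (simp add: finite_PiE)
  have cG: "card ?G = k ^ card V" using fV by (simp add: card_PiE)
  have "card ?G \<noteq> 0" using assms(4) cG by simp
  then have Gne: "?G \<noteq> {}" by (metis card.empty)
  \<comment> \<open>The values on the \<open>n\<close> vertices of \<open>e\<close> are forced,
    those on the other \<open>card V - n\<close> are free.\<close>
  have cnt: "card {g \<in> ?G. \<forall>x\<in>e. g x = i} * k ^ n = k ^ card V" if e: "e \<in> E" and i: "i < k" for e i
  proof -
    have eV: "e \<subseteq> V" using e EV by auto
    have ce: "card e = n" using e assms(2) by (auto simp: uniform_def)
    have "{g \<in> ?G. \<forall>x\<in>e. g x = i} = PiE V (\<lambda>x. if x \<in> e then {i} else {..<k})"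
      proof (intro set_eqI iffI)
      fix g assume "g \<in> {g \<in> ?G. \<forall>x\<in>e. g x = i}"
      then show "g \<in> PiE V (\<lambda>x. if x \<in> e then {i} else {..<k})" by (simp add: PiE_iff)
    next
      fix g assume g: "g \<in> PiE V (\<lambda>x. if x \<in> e then {i} else {..<k})"
      then have gx: "g x \<in> (if x \<in> e then {i} else {..<k})" if "x \<in> V" for x
        using that by (auto simp: PiE_iff)
      have "g x < k" if "x \<in> V" for x using gx[OF that] i by (auto split: if_splits)
      moreover have "g x = i" if "x \<in> e" for x using gx[of x] that eV by auto
      ultimately show "g \<in> {g \<in> ?G. \<forall>x\<in>e. g x = i}" using g by (simp add: PiE_iff)
    qed
    then have "card {g \<in> ?G. \<forall>x\<in>e. g x = i} = (\<Prod>x\<in>V. if x \<in> e then 1 else k)"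
      using fV by (simp add: card_PiE if_distrib cong: if_cong)
    also have "\<dots> = k ^ card (V - e)"
    proof -
      have "V \<inter> {x. x \<in> e} = e" "V \<inter> - {x. x \<in> e} = V - e" using eV by auto
      then show ?thesis using fV by (simp add: prod.If_cases)
    qed
    also have "card (V - e) = card V - n"
      using eV fV ce by (metis card_Diff_subset finite_subset)
    finally have "card {g \<in> ?G. \<forall>x\<in>e. g x = i} * k ^ n = k ^ (card V - n + n)"
      by (simp add: power_add)
    then show ?thesis using card_mono[OF fV eV] ce by simp
  qed
  have "(\<Sum>g\<in>?G. ?M g) = (\<Sum>g\<in>?G. \<Sum>i<k. \<Sum>e\<in>E. if \<forall>x\<in>e. g x = i then 1 else 0)"
    using fE by (simp add: sum.If_cases Int_def)
  also have "\<dots> = (\<Sum>i<k. \<Sum>e\<in>E. \<Sum>g\<in>?G. if \<forall>x\<in>e. g x = i then 1 else 0)"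
    by (subst sum.swap) (intro sum.cong refl sum.swap)
  also have "\<dots> = (\<Sum>i<k. \<Sum>e\<in>E. card {g \<in> ?G. \<forall>x\<in>e. g x = i})"
    using fG by (simp add: sum.If_cases Int_def)
  finally have "(\<Sum>g\<in>?G. ?M g) * k ^ n = (\<Sum>i<k. \<Sum>e\<in>E. card {g \<in> ?G. \<forall>x\<in>e. g x = i} * k ^ n)"
    by (simp add: sum_distrib_right)
  also have "\<dots> = (\<Sum>i<k. \<Sum>e\<in>E. k ^ card V)"
    by (intro sum.cong refl cnt) auto
  also have "\<dots> = k * (card E * k ^ card V)" by simp
  finally have 1: "(\<Sum>g\<in>?G. ?M g) * k ^ (n - 1) = card E * k ^ card V"
    using assms(3,4) by (cases n) auto
  \<comment> \<open>By \<open>neg\<close> every \<open>g\<close> exceeds the bound strictly, so the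
    total would exceed the exact value in \<open>1\<close>.\<close>
  have "(\<Sum>g\<in>?G. card E) < (\<Sum>g\<in>?G. ?M g * k ^ (n - 1))"
    using neg by (intro sum_strict_mono fG Gne) (force simp: PiE_def)
  then show False using 1 cG by (simp add: sum_distrib_right)
qed

text \<open>Disjoint palettes: an edge inside one part is handled by the coloring of that part, an
  edge meeting two parts sees two palettes.\<close>

lemma colorable_partition:
  fixes V :: "'a set" and R :: "nat \<Rightarrow> nat"
  assumes g: "g \<in> V \<rightarrow> {..<k}" and EV: "E \<subseteq> Pow V" and ne: "{} \<notin> E"
    and col: "\<And>i. i < k \<Longrightarrow> colorable {x \<in> V. g x = i} {e \<in> E. \<forall>x\<in>e. g x = i} (R i)"
  shows "colorable V E (\<Sum>i<k. R i)"
proof -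
  have "\<forall>i. \<exists>c. i < k \<longrightarrow> coloring {x \<in> V. g x = i} (R i) c \<and> proper {e \<in> E. \<forall>x\<in>e. g x = i} c"
    using col unfolding colorable_def by blast
  from choice[OF this] obtain c where c: "\<And>i. i < k \<Longrightarrow> coloring {x \<in> V. g x = i} (R i) (c i)"
    "\<And>i. i < k \<Longrightarrow> proper {e \<in> E. \<forall>x\<in>e. g x = i} (c i)" by blast
  have rng: "1 \<le> c (g x) x" "c (g x) x \<le> R (g x)" "g x < k" if "x \<in> V" for x
    using c(1)[of "g x"] g that by (auto simp: coloring_def Pi_def)
  \<comment> \<open>Part \<open>i\<close> gets the \<open>R i\<close> consecutive colors following
    those of all earlier parts.\<close>
  define d where "d x = (\<Sum>j<g x. R j) + c (g x) x" for x
  have upper: "d x \<le> (\<Sum>j<l. R j)" if "x \<in> V" "g x < l" for x l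
  proof -
    have "d x \<le> (\<Sum>j<Suc (g x). R j)" using rng[OF that(1)] by (simp add: d_def)
    also have "\<dots> \<le> (\<Sum>j<l. R j)" using that by (intro sum_mono2) auto
    finally show ?thesis .
  qed
  have sep: "d x < d y" if "x \<in> V" "y \<in> V" "g x < g y" for x y
    using upper[OF that(1,3)] rng(1)[OF that(2)] by (simp add: d_def)
  have "coloring V (\<Sum>i<k. R i) d"
    unfolding coloring_def using rng upper by (force simp: d_def)
  moreover have "proper E d"
    unfolding proper_def
  proof
    fix e assume e: "e \<in> E"
    then have eV: "e \<subseteq> V" using EV by auto
    obtain x where x: "x \<in> e" using e ne by (metis equals0I)
    show "\<exists>x\<in>e. \<exists>y\<in>e. d x \<noteq> d y"
    proof (cases "\<forall>y\<in>e. g y = g x")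
      case True
      have "g x < k" using rng x eV by auto
      from c(2)[OF this] obtain y z where "y \<in> e" "z \<in> e" "c (g x) y \<noteq> c (g x) z"
        using True e unfolding proper_def by blast
      then show ?thesis using True by (metis add_left_cancel d_def)
    next
      case False
      then obtain y where y: "y \<in> e" "g y \<noteq> g x" by blast
      then have "d x \<noteq> d y" using sep x eV by (metis nat_neq_iff subsetD)
      then show ?thesis using x y by blast
    qed
  qed
  ultimately show ?thesis unfolding colorable_def by blast
qed

lemma max_chromatic_split:
  assumes "n \<ge> 2" "k \<ge> 1"
  shows "\<exists>a. (\<Sum>i<k. a i) * k ^ (n - 1) \<le> N \<and> max_chromatic n N \<le> (\<Sum>i<k. max_chromatic n (a i))"
proof -
  \<comment> \<open>An extremal hypergraph: one that is not colorable with the predecessor of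
    \<open>max_chromatic n N\<close>. For the value 0 the condition is vacuous and the empty
    hypergraph serves.\<close>
  have "\<exists>(V :: nat set) E. hypergraph V E \<and> uniform n E \<and> card E \<le> N
      \<and> (\<forall>r < max_chromatic n N. \<not> colorable V E r)"
  proof (cases "max_chromatic n N")
    case 0
    then show ?thesis
      by (intro exI[of _ "{}"]) (auto simp: hypergraph_def uniform_def)
  next
    case (Suc r)
    then obtain V :: "nat set" and E where h: "hypergraph V E" "uniform n E" "card E \<le> N" "\<not> colorable V E r"
      using max_chromatic_le[of n N r] by force
    moreover have "\<not> colorable V E s" if "s < max_chromatic n N" for s
      using h(4) colorable_mono[of V E s r] that Suc by auto
    ultimately show ?thesis by blast
  qed
  then obtain V :: "nat set" and E where h: "hypergraph V E" "uniform n E" "card E \<le> N"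
    and nc: "\<And>r. r < max_chromatic n N \<Longrightarrow> \<not> colorable V E r" by blast
  obtain g where g: "g \<in> V \<rightarrow> {..<k}"
    and gs: "(\<Sum>i<k. card {e \<in> E. \<forall>x\<in>e. g x = i}) * k ^ (n - 1) \<le> card E"
    using exists_partition_few_monochromatic[OF h(1,2) _ assms(2)] assms(1) by auto
  define a where "a i = card {e \<in> E. \<forall>x\<in>e. g x = i}" for i
  have EV: "E \<subseteq> Pow V" and fV: "finite V" using h by (auto simp: hypergraph_def)
  have ne: "{} \<notin> E" using h(2) assms(1) by (auto simp: uniform_def)
  have "colorable V E (\<Sum>i<k. max_chromatic n (a i))"
  proof (rule colorable_partition[OF g EV ne])
    fix i
    show "colorable {x \<in> V. g x = i} {e \<in> E. \<forall>x\<in>e. g x = i} (max_chromatic n (a i))"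
      using EV fV h(2) assms(1)
      by (intro colorable_max_chromatic) (auto simp: hypergraph_def uniform_def a_def)
  qed
  then have "max_chromatic n N \<le> (\<Sum>i<k. max_chromatic n (a i))" using nc not_less by blast
  then show ?thesis using gs h(3) unfolding a_def by (intro exI conjI) auto
qed

text \<open>With \<open>k\<close> about \<open>root n N\<close> parts, at most \<open>k\<close>
  edges survive inside parts, so the trivial bound \<open>Suc (a i)\<close> sums to at most
  \<open>2 * k\<close>. Rounding up at most doubles \<open>k\<close>.\<close>

lemma max_chromatic_le_root:
  assumes "n \<ge> 2" "N \<ge> 1"
  shows "real (max_chromatic n N) \<le> 4 * root n (real N)"
proof -
  have r1: "root n (real N) \<ge> 1" using assms by simp
  define k where "k = nat \<lceil>root n (real N)\<rceil>"
  have k: "real k \<ge> root n (real N)" "real k \<le> root n (real N) + 1" "k \<ge> 1"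
    using r1 unfolding k_def by linarith+
  have "real N = root n (real N) ^ n" using assms by simp
  also have "\<dots> \<le> real k ^ n" using k r1 by (intro power_mono) auto
  finally have "N \<le> k ^ n" by (metis of_nat_le_iff of_nat_power)
  moreover obtain a where a: "(\<Sum>i<k. a i) * k ^ (n - 1) \<le> N"
    "max_chromatic n N \<le> (\<Sum>i<k. max_chromatic n (a i))"
    using max_chromatic_split[OF assms(1) k(3)] by blast
  moreover have "k ^ n = k * k ^ (n - 1)" using assms(1) by (cases n) auto
  ultimately have "(\<Sum>i<k. a i) * k ^ (n - 1) \<le> k * k ^ (n - 1)" by linarith
  then have s: "(\<Sum>i<k. a i) \<le> k" using k(3) by simp
  have "(\<Sum>i<k. max_chromatic n (a i)) \<le> (\<Sum>i<k. Suc (a i))"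
    by (intro sum_mono max_chromatic_le_Suc assms)
  also have "\<dots> = (\<Sum>i<k. a i) + k" by (simp add: sum_Suc)
  finally have "max_chromatic n N \<le> 2 * k" using a s by linarith
  then show ?thesis using k r1 by linarith
qed

section \<open>Convergence from the splitting inequality\<close>

text \<open>Strict convexity of \<open>z ^ n\<close> at 1 with an explicit quadratic gain; this is
  the strict concavity of the root in the overview.\<close>

lemma power_minus_tangent_ge:
  fixes z :: real
  assumes "z \<ge> 0" "n \<ge> 2"
  shows "z ^ n \<ge> 1 + real n * (z - 1) + (z - 1)\<^sup>2"
  using assms(2)
proof (induction n rule: dec_induct)
  case base
  then show ?case by (simp add: power2_eq_square algebra_simps)
next
  case (step n)
  have "z * z ^ n \<ge> z * (1 + real n * (z - 1) + (z - 1)\<^sup>2)"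
    using step assms(1) by (intro mult_left_mono) auto
  moreover have "z * (1 + real n * (z - 1) + (z - 1)\<^sup>2)
      = 1 + real (Suc n) * (z - 1) + (z - 1)\<^sup>2 + ((real n - 1) * (z - 1)\<^sup>2 + z * (z - 1)\<^sup>2)"
    by (simp add: power2_eq_square algebra_simps)
  moreover have "(real n - 1) * (z - 1)\<^sup>2 + z * (z - 1)\<^sup>2 \<ge> 0"
    using step assms(1) by simp
  ultimately show ?case by simp
qed

text \<open>\<open>u\<close> is the limit superior, obtained as the limit of the decreasing tail
  suprema \<open>S\<close>.\<close>

lemma bounded_seq_limsup:
  fixes h :: "nat \<Rightarrow> real"
  assumes "\<And>N. 0 \<le> h N" "\<And>N. h N \<le> C"
  obtains u where "\<And>e. e > 0 \<Longrightarrow> \<exists>M. \<forall>N\<ge>M. h N \<le> u + e"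
    and "\<And>e M. e > 0 \<Longrightarrow> \<exists>N\<ge>M. h N \<ge> u - e"
proof -
  define S where "S M = (SUP N\<in>{M..}. h N)" for M
  have bdd: "bdd_above (h ` {M..})" for M using assms(2) by (auto intro!: bdd_aboveI2)
  have hS: "h N \<le> S M" if "N \<ge> M" for N M
    unfolding S_def using bdd that by (intro cSUP_upper) auto
  have "decseq S"
    unfolding decseq_def S_def using bdd by (intro allI impI cSUP_subset_mono) auto
  moreover have "0 \<le> S M" for M using assms(1)[of M] hS[of M M] by simp
  ultimately obtain u where u: "S \<longlonglongrightarrow> u" "\<And>i. u \<le> S i"
    using decseq_convergent[of S 0] by metis
  show ?thesis
  proof
    fix e :: real assume e: "e > 0"
    then have "\<forall>\<^sub>F M in sequentially. S M < u + e" using order_tendstoD(2)[OF u(1)] by simp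
    then obtain M where "S M < u + e" by (meson eventually_sequentially order_refl)
    then show "\<exists>M. \<forall>N\<ge>M. h N \<le> u + e" using hS by (meson less_imp_le order_trans)
    fix M
    have "u - e < S M" using u(2)[of M] e by simp
    then obtain N where "N \<ge> M" "u - e < h N"
      unfolding S_def using less_cSUP_iff[OF _ bdd] by auto
    then show "\<exists>N\<ge>M. h N \<ge> u - e" by (meson less_imp_le)
  qed
qed

text \<open>The limit is the limit superior \<open>u\<close> of \<open>h\<close>, finite by
  \<open>bound\<close>; \<open>low\<close> carries out the argument of the overview by
  contradiction.\<close>

lemma convergent_of_split:
  fixes f :: "nat \<Rightarrow> real"
  assumes n: "n \<ge> 2" and pos: "\<And>N. 0 \<le> f N" and mono: "\<And>N N'. N \<le> N' \<Longrightarrow> f N \<le> f N'"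
    and bound: "\<And>N. N \<ge> 1 \<Longrightarrow> f N \<le> C * root n (real N)"
    and split: "\<And>N k. k \<ge> 1 \<Longrightarrow> \<exists>a. (\<Sum>i<k. a i) * k ^ (n - 1) \<le> N \<and> f N \<le> (\<Sum>i<k. f (a i))"
  shows "convergent (\<lambda>N. f N / root n (real N))"
proof -
  define h where "h N = f N / root n (real N)" for N
  have rp: "root n (real N) > 0" if "N \<ge> 1" for N using that n by simp
  have fh: "f N = h N * root n (real N)" if "N \<ge> 1" for N using rp[OF that] by (simp add: h_def)
  have h0: "0 \<le> h N" for N using pos[of N] n by (simp add: h_def)
  have hC: "h N \<le> \<bar>C\<bar>" for N
  proof (cases "N \<ge> 1")
    case True
    then have "h N \<le> C" using bound[OF True] rp[OF True] by (simp add: h_def field_simps)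
    then show ?thesis by simp
  next
    \<comment> \<open>Here \<open>h 0 = 0\<close>, as \<open>root n 0 = 0\<close> and division by
      zero yields 0.\<close>
    case False
    then have "N = 0" by simp
    then show ?thesis by (simp add: h_def)
  qed
  obtain u where up: "\<And>e. e > 0 \<Longrightarrow> \<exists>M. \<forall>N\<ge>M. h N \<le> u + e"
    and lo: "\<And>e M. e > 0 \<Longrightarrow> \<exists>N\<ge>M. h N \<ge> u - e"
    using bounded_seq_limsup[of h "\<bar>C\<bar>", OF h0 hC] by blast
  have inf: "LIM N sequentially. root n (real N) :> at_top"
    unfolding filterlim_at_top
  proof
    fix Z :: real
    have "Z \<le> root n (real N)" if "N \<ge> nat \<lceil>(max 0 Z) ^ n\<rceil>" for N
    proof -
      have "(max 0 Z) ^ n \<le> real N" using that by linarith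
      then have "root n ((max 0 Z) ^ n) \<le> root n (real N)" using n by simp
      then show ?thesis using n by (simp add: real_root_power_cancel)
    qed
    then show "\<forall>\<^sub>F N in sequentially. Z \<le> root n (real N)"
      unfolding eventually_sequentially by blast
  qed
  have low: "\<exists>M. \<forall>N\<ge>M. h N > u - d" if d: "d > 0" for d
  proof (rule ccontr)
    assume "\<not> ?thesis"
    then have freq: "\<exists>N\<ge>M. h N \<le> u - d" for M by (meson not_less)
    have ud: "u \<ge> d" using freq[of 0] h0 by (metis diff_ge_0_iff_ge order_trans)
    have u0: "u > 0" using ud d by simp
    \<comment> \<open>The drop \<open>d = 4 * t * u\<close> at \<open>x\<close> has to pay
      \<open>2 * t * u\<close> for the gap between \<open>X\<close> and \<open>s\<close>,
      \<open>t * u\<close> for the slope of the tangent, and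
      \<open>\<gamma> \<le> u * t\<close>.\<close>
    define t where "t = d / (4 * u)"
    have t: "0 < t" "t \<le> 1/4" "4 * t * u = d" using u0 d ud by (auto simp: t_def field_simps)
    \<comment> \<open>Small enough that \<open>\<gamma> * (z + 1)\<close> is below the quadratic
      gain whenever \<open>\<bar>z - 1\<bar> \<ge> t\<close>; the 3 comes from
      \<open>t\<^sup>2 * (z + 1) \<le> 3 * (z - 1)\<^sup>2\<close>.\<close>
    define \<gamma> where "\<gamma> = u * t\<^sup>2 / (3 * real n)"
    have n0: "real n \<ge> 2" using n by simp
    have g0: "\<gamma> > 0" using t u0 n0 by (simp add: \<gamma>_def)
    have g3: "3 * \<gamma> = u / real n * t\<^sup>2" using n0 by (simp add: \<gamma>_def)
    have un: "u / real n \<le> u / 2" using u0 n0 by (simp add: field_simps)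
    have g1: "\<gamma> \<le> u * t"
    proof -
      have "3 * \<gamma> \<le> u / 2 * t\<^sup>2" unfolding g3 using un by (intro mult_right_mono) auto
      also have "\<dots> \<le> u / 2 * t" using t u0 by (intro mult_left_mono) (auto simp: power2_eq_square)
      finally show ?thesis using g0 t u0 by auto
    qed
    have g2: "\<gamma> \<le> u / 4"
    proof -
      have "u * t \<le> u * (1/4)" using t u0 by (intro mult_left_mono) auto
      then show ?thesis using g1 by simp
    qed
    obtain M0 where M0: "\<And>N. N \<ge> M0 \<Longrightarrow> h N \<le> u + \<gamma>" using up[OF g0] by blast
    define M where "M = max 1 M0"
    have M: "h N \<le> u + \<gamma>" "N \<ge> 1" if "N \<ge> M" for N using M0 that by (auto simp: M_def)
    \<comment> \<open>Chosen so that every part with fewer than \<open>M\<close> edges has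
      \<open>f a \<le> u / 4 * s\<close>.\<close>
    have "\<forall>\<^sub>F N in sequentially. root n (real N) \<ge> 8 * f M / u"
      using inf unfolding filterlim_at_top by blast
    then obtain M1 where M1: "\<And>N. N \<ge> M1 \<Longrightarrow> root n (real N) \<ge> 8 * f M / u"
      unfolding eventually_sequentially by blast
    obtain x where x: "x \<ge> max 1 M1" "h x \<le> u - d" using freq by blast
    define X where "X = root n (real x)"
    have X0: "X > 0" using rp x unfolding X_def by simp
    have XM: "X \<ge> 8 * f M / u" using M1 x unfolding X_def by simp
    have fx: "f x \<le> (u - d) * X" using fh[of x] x X0 unfolding X_def
      by (simp add: mult_right_mono)
    have "\<forall>\<^sub>F N in sequentially. root n (real N) \<ge> X / t"
      using inf unfolding filterlim_at_top by blast
    then obtain M2 where M2: "\<And>N. N \<ge> M2 \<Longrightarrow> root n (real N) \<ge> X / t"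
      unfolding eventually_sequentially by blast
    obtain N where N: "N \<ge> max 1 M2" "h N \<ge> u - \<gamma> / 2" using lo[of "\<gamma>/2" "max 1 M2"] g0 by auto
    define T where "T = root n (real N)"
    have T0: "T > 0" using rp N unfolding T_def by simp
    have TX: "t * T \<ge> X" using M2[of N] N t unfolding T_def by (simp add: field_simps)
    \<comment> \<open>Places \<open>s = T / k\<close> slightly below \<open>X\<close>, with
      \<open>(1 + t) * s \<le> X \<le> (1 + 2 * t) * s\<close>. Rounding up costs at most
      \<open>X \<le> t * T\<close>, which is why \<open>N\<close> is taken so much larger than
      \<open>x\<close>.\<close>
    define k where "k = nat \<lceil>(1 + t) * T / X\<rceil>"
    have k1: "real k \<ge> (1 + t) * T / X" "real k \<le> (1 + t) * T / X + 1"
      using t T0 X0 unfolding k_def by (auto intro: of_nat_ceiling)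
    have k0: "real k > 0" using k1(1) t T0 X0 by (smt (verit) divide_pos_pos mult_pos_pos)
    define s where "s = T / real k"
    have s0: "s > 0" using T0 k0 by (simp add: s_def)
    have sX1: "(1 + t) * s \<le> X" using k1(1) k0 X0 by (simp add: s_def field_simps)
    have sX2: "X \<le> (1 + 2 * t) * s"
    proof -
      have "real k * X \<le> (1 + t) * T + X" using k1(2) X0 by (simp add: field_simps)
      also have "\<dots> \<le> (1 + 2 * t) * T" using TX by (simp add: algebra_simps)
      finally show ?thesis using k0 by (simp add: s_def field_simps)
    qed
    text \<open>The line on the right is the tangent to \<open>u * b powr (1 / n)\<close> at \<open>b = 1\<close> lowered by \<open>\<gamma>\<close>.
      Away from \<open>b = 1\<close> it dominates by strict concavity, near \<open>b = 1\<close> because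
      \<open>f\<close> is small at \<open>x\<close> and monotone.\<close>
    have key: "f a / s \<le> u - \<gamma> + u / real n * (real a / s ^ n - 1)" for a
    proof -
      define z where "z = root n (real a) / s"
      have z0: "z \<ge> 0" using s0 n by (simp add: z_def)
      have zn: "z ^ n = real a / s ^ n" using n by (simp add: z_def power_divide)
      have tan: "u / real n * (z ^ n - 1) \<ge> u * (z - 1) + u / real n * (z - 1)\<^sup>2"
      proof -
        have "u / real n * (z ^ n - 1) \<ge> u / real n * (real n * (z - 1) + (z - 1)\<^sup>2)"
          using power_minus_tangent_ge[OF z0 n] u0 by (intro mult_left_mono) auto
        then show ?thesis using n0 by (simp add: algebra_simps)
      qed
      have sq: "u / real n * (z - 1)\<^sup>2 \<ge> 0" using u0 by simp
      consider "a < M" | "a \<ge> M" "\<bar>z - 1\<bar> < t" | "a \<ge> M" "\<bar>z - 1\<bar> \<ge> t" by linarith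
      then have "f a / s \<le> u - \<gamma> + u / real n * (z ^ n - 1)"
      proof cases
        case 1
        \<comment> \<open>The line is lowest at \<open>z = 0\<close>, where it is still at least
          \<open>u - u / 4 - u / 2 = u / 4\<close>.\<close>
        have "8 * f M \<le> u * X" using XM u0 by (simp add: field_simps)
        also have "\<dots> \<le> u * (2 * s)"
        proof -
          have "(1 + 2 * t) * s \<le> 2 * s" using t s0 by (intro mult_right_mono) auto
          then show ?thesis using sX2 u0 by (intro mult_left_mono) auto
        qed
        finally have "f a \<le> u / 4 * s" using mono[of a M] 1 by (simp add: mult.commute)
        then have "f a / s \<le> u / 4" using s0 by (simp add: field_simps)
        moreover have "u / real n * (z ^ n - 1) \<ge> - (u / real n)"
        proof -
          have "u / real n * (z ^ n - 1) \<ge> u / real n * (- 1)"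
            using z0 u0 by (intro mult_left_mono) auto
          then show ?thesis by simp
        qed
        ultimately show ?thesis using un g2 by linarith
      next
        case 2
        \<comment> \<open>Since \<open>z < 1 + t\<close>, \<open>a\<close> is at most
          \<open>x\<close>, and monotonicity transfers the drop \<open>d\<close> from
          \<open>x\<close> to \<open>a\<close>.\<close>
        have "root n (real a) = z * s" using s0 by (simp add: z_def)
        also have "\<dots> \<le> (1 + t) * s" using 2 s0 by (intro mult_right_mono) auto
        finally have "root n (real a) \<le> root n (real x)" using sX1 unfolding X_def by simp
        then have "a \<le> x" using n by simp
        then have "f a \<le> (u - d) * X" using mono fx order_trans by blast
        also have "\<dots> \<le> (u - d) * ((1 + 2 * t) * s)" using sX2 ud by (intro mult_left_mono) auto
        finally have "f a / s \<le> (u - d) * (1 + 2 * t)" using s0 by (simp add: field_simps)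
        also have "\<dots> \<le> u - d + 2 * (t * u)"
          using d t by (simp add: algebra_simps)
        also have "\<dots> = u - 2 * (t * u)" using t(3) by (simp add: algebra_simps)
        finally have "f a / s \<le> u - 2 * (t * u)" .
        moreover have "u * (z - 1) \<ge> u * (- t)" using 2 u0 by (intro mult_left_mono) auto
        moreover have "u * t = t * u" by simp
        ultimately show ?thesis using tan sq g1 by (smt (verit) mult_minus_right)
      next
        case 3
        have "f a \<le> (u + \<gamma>) * root n (real a)"
          using fh[OF M(2)] M(1) rp[OF M(2)] 3(1) by (simp add: mult_right_mono)
        then have A: "f a / s \<le> (u + \<gamma>) * z" using s0 by (simp add: z_def field_simps)
        have t2: "t\<^sup>2 \<le> (z - 1)\<^sup>2" using 3 t by (metis abs_le_square_iff abs_of_pos)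
        have "t * \<bar>z - 1\<bar> \<le> (z - 1)\<^sup>2"
        proof -
          have "t * \<bar>z - 1\<bar> \<le> \<bar>z - 1\<bar> * \<bar>z - 1\<bar>" using 3 by (intro mult_right_mono) auto
          then show ?thesis by (simp add: power2_eq_square)
        qed
        moreover have "t\<^sup>2 * \<bar>z - 1\<bar> \<le> t * \<bar>z - 1\<bar>"
          using t by (intro mult_right_mono) (auto simp: power2_eq_square)
        moreover have "t\<^sup>2 * (z + 1) \<le> t\<^sup>2 * (\<bar>z - 1\<bar> + 2)" by (intro mult_left_mono) auto
        ultimately have "t\<^sup>2 * (z + 1) \<le> 3 * (z - 1)\<^sup>2" using t2 by (simp add: algebra_simps)
        then have "u / real n * (t\<^sup>2 * (z + 1)) \<le> u / real n * (3 * (z - 1)\<^sup>2)"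
          using u0 by (intro mult_left_mono) auto
        then have "3 * \<gamma> * (z + 1) \<le> 3 * (u / real n * (z - 1)\<^sup>2)" unfolding g3 by (simp add: mult_ac)
        then have "\<gamma> * (z + 1) \<le> u / real n * (z - 1)\<^sup>2" by linarith
        then have "\<gamma> * z + \<gamma> \<le> u / real n * (z - 1)\<^sup>2" by (simp add: distrib_left)
        then show ?thesis using A tan by (simp add: algebra_simps)
      qed
      then show ?thesis unfolding zn .
    qed
    have "k \<ge> 1" using k0 by simp
    then obtain a where a: "(\<Sum>i<k. a i) * k ^ (n - 1) \<le> N" "f N \<le> (\<Sum>i<k. f (a i))"
      using split by blast
    have Tn: "T ^ n = real N" using n by (simp add: T_def)
    \<comment> \<open>The part sizes average at most \<open>s ^ n = N / k ^ n\<close>, so the linear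
      terms of \<open>key\<close> sum to at most 0. What remains,
      \<open>f N \<le> (u - \<gamma>) * T\<close>, contradicts the choice of
      \<open>N\<close>.\<close>
    have "(\<Sum>i<k. real (a i) / s ^ n) \<le> real k"
    proof -
      have "real ((\<Sum>i<k. a i) * k ^ (n - 1)) \<le> real N" using a(1) by (simp only: of_nat_le_iff)
      then have "(\<Sum>i<k. real (a i)) * real k ^ (n - 1) \<le> T ^ n" using Tn by simp
      then have "(\<Sum>i<k. real (a i)) * real k ^ (n - 1) * real k \<le> T ^ n * real k"
        using k0 by (intro mult_right_mono) auto
      moreover have "real k ^ (n - 1) * real k = real k ^ n" using n by (cases n) auto
      ultimately have "(\<Sum>i<k. real (a i)) * real k ^ n \<le> T ^ n * real k"
        by (simp only: mult.assoc)
      then have "(\<Sum>i<k. real (a i)) * real k ^ n / T ^ n \<le> real k"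
        using T0 by (simp add: field_simps)
      then show ?thesis by (simp add: s_def power_divide sum_divide_distrib sum_distrib_right)
    qed
    then have "u / real n * ((\<Sum>i<k. real (a i) / s ^ n) - real k) \<le> 0"
      using u0 n0 by (intro mult_nonneg_nonpos) auto
    moreover have "(\<Sum>i<k. f (a i) / s) \<le> (\<Sum>i<k. u - \<gamma> + u / real n * (real (a i) / s ^ n - 1))"
      by (intro sum_mono key)
    moreover have "(\<Sum>i<k. u - \<gamma> + u / real n * (real (a i) / s ^ n - 1))
        = real k * (u - \<gamma>) + u / real n * ((\<Sum>i<k. real (a i) / s ^ n) - real k)"
      unfolding sum.distrib sum_distrib_left[symmetric] sum_subtractf by (simp add: right_diff_distrib)
    ultimately have "(\<Sum>i<k. f (a i)) / s \<le> real k * (u - \<gamma>)"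
      by (simp add: sum_divide_distrib)
    then have "f N / s \<le> real k * (u - \<gamma>)"
      using a(2) s0 by (meson divide_right_mono less_imp_le order_trans)
    then have "f N \<le> real k * (u - \<gamma>) * s" using s0 by (simp only: pos_divide_le_eq)
    also have "\<dots> = (u - \<gamma>) * T" using k0 by (simp add: s_def)
    finally have "f N \<le> (u - \<gamma>) * T" .
    moreover have "f N \<ge> (u - \<gamma> / 2) * T"
      using fh[of N] N T0 unfolding T_def by (simp add: mult_right_mono)
    ultimately have "(u - \<gamma> / 2) * T \<le> (u - \<gamma>) * T" by linarith
    then show False using T0 g0 by simp
  qed
  have "h \<longlonglongrightarrow> u"
  proof (rule LIMSEQ_I)
    fix e :: real assume "e > 0"
    then obtain M1 M2 where "\<forall>N\<ge>M1. h N \<le> u + e / 2" "\<forall>N\<ge>M2. h N > u - e"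
      using up[of "e/2"] low[of e] by auto
    then have "\<forall>N\<ge>max M1 M2. norm (h N - u) < e"
      using \<open>e > 0\<close> by (smt (verit) field_sum_of_halves max.bounded_iff real_norm_def)
    then show "\<exists>M. \<forall>N\<ge>M. norm (h N - u) < e" by blast
  qed
  then show ?thesis unfolding h_def convergent_def by blast
qed

section \<open>Inverting the asymptotics of \<open>max_chromatic\<close>\<close>

theorem theorem1:
  fixes n :: nat
  assumes "n \<ge> 2"
  shows "convergent (\<lambda>r. real (m n r) / real r ^ n)"
proof -
  let ?F = "\<lambda>N. real (max_chromatic n N)"
  let ?h = "\<lambda>N. ?F N / root n (real N)"
  have "convergent ?h"
  proof (rule convergent_of_split[OF assms])
    fix N k :: nat assume "k \<ge> 1"
    then show "\<exists>a. (\<Sum>i<k. a i) * k ^ (n - 1) \<le> N \<and> ?F N \<le> (\<Sum>i<k. ?F (a i))"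
      using max_chromatic_split[OF assms, of k N] by (metis of_nat_le_iff of_nat_sum)
  qed (use assms max_chromatic_mono max_chromatic_le_root in auto)
  then obtain L where L: "?h \<longlonglongrightarrow> L" unfolding convergent_def by blast
  have mr: "m n r \<ge> r" for r
  proof (cases r)
    case (Suc q)
    then show ?thesis using less_m_iff[OF assms, of q r] max_chromatic_le_Suc[OF assms, of q] by simp
  qed simp
  have m_inf: "LIM r sequentially. m n r :> sequentially"
    by (rule filterlim_at_top_mono[OF filterlim_ident]) (simp add: mr)
  have m1_inf: "LIM r sequentially. m n r - 1 :> sequentially"
    by (rule filterlim_at_top_mono[OF filterlim_minus_const_nat_at_top[of 1]]) (simp add: mr diff_le_mono)
  have hi: "(\<lambda>r. ?h (m n r)) \<longlonglongrightarrow> L" and lo: "(\<lambda>r. ?h (m n r - 1)) \<longlonglongrightarrow> L"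
    using filterlim_compose[OF L m_inf] filterlim_compose[OF L m1_inf] by simp_all
  have rpos: "root n (real (m n r)) > 0" if "r \<ge> 1" for r
    using mr[of r] that assms by simp
  \<comment> \<open>\<open>m n r\<close> is the first \<open>N\<close> with
    \<open>max_chromatic n N > r\<close>; evaluating \<open>?h\<close> there and one step earlier
    squeezes \<open>r / root n (m n r)\<close>.\<close>
  have up: "real r / root n (real (m n r)) \<le> ?h (m n r)" if "r \<ge> 1" for r
  proof -
    have "r \<le> max_chromatic n (m n r)" using less_m_iff[OF assms, of "m n r" r] by simp
    then show ?thesis using rpos[OF that] by (intro divide_right_mono) auto
  qed
  \<comment> \<open>Positivity permits taking the inverse of the limit at the end.\<close>
  have Lpos: "L > 0"
  proof -
    have "1 / real (Suc n) \<le> ?h (m n r)" if "r \<ge> 1" for r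
    proof -
      have "real (m n r) \<le> (real r * real (Suc n)) ^ n"
        using m_le[OF assms that] by (metis of_nat_le_iff of_nat_mult of_nat_power)
      then have "root n (real (m n r)) \<le> root n ((real r * real (Suc n)) ^ n)" using assms by simp
      also have "\<dots> = real r * real (Suc n)" using assms by (intro real_root_power_cancel) auto
      finally have "1 / real (Suc n) \<le> real r / root n (real (m n r))"
        using rpos[OF that] by (simp add: field_simps)
      then show ?thesis using up[OF that] by linarith
    qed
    then have "1 / real (Suc n) \<le> L"
      by (intro tendsto_lowerbound[OF hi] eventually_sequentiallyI[of 1]) auto
    then show ?thesis by (smt (verit) divide_pos_pos of_nat_0_less_iff zero_less_Suc)
  qed
  \<comment> \<open>Replaces the denominator \<open>root n (m n r - 1)\<close> by
    \<open>root n (m n r)\<close> in the lower bound.\<close>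
  let ?q = "\<lambda>N. root n (real (N - 1) / real N)"
  have "(\<lambda>N. real (N - 1) / real N) \<longlonglongrightarrow> 1"
  proof -
    have "(\<lambda>N. 1 - 1 / real N) \<longlonglongrightarrow> 1 - 0" by (intro tendsto_intros lim_1_over_n)
    then have "(\<lambda>N. 1 - 1 / real N) \<longlonglongrightarrow> 1" by simp
    then show ?thesis
      by (rule Lim_transform_eventually[OF _ eventually_sequentiallyI[of 1]])
         (auto simp: of_nat_diff field_simps)
  qed
  then have "?q \<longlonglongrightarrow> root n 1" by (intro tendsto_real_root)
  then have "(\<lambda>r. ?q (m n r)) \<longlonglongrightarrow> 1" using filterlim_compose[OF _ m_inf] assms by simp
  then have lo': "(\<lambda>r. ?h (m n r - 1) * ?q (m n r)) \<longlonglongrightarrow> L" using tendsto_mult[OF lo] by force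
  \<comment> \<open>For \<open>r \<ge> 2\<close>, \<open>mr\<close> gives
    \<open>m n r - 1 > 0\<close>, so its root is nonzero and cancels.\<close>
  have down: "?h (m n r - 1) * ?q (m n r) \<le> real r / root n (real (m n r))" if "r \<ge> 2" for r
  proof -
    have p: "m n r - 1 < m n r" "real (m n r - 1) > 0" using mr[of r] that by auto
    then have "max_chromatic n (m n r - 1) \<le> r" using less_m_iff[OF assms] by blast
    then have "?F (m n r - 1) / root n (real (m n r)) \<le> real r / root n (real (m n r))"
      using rpos[of r] that by (intro divide_right_mono) auto
    moreover have "root n (real (m n r - 1)) > 0" using p assms by simp
    ultimately show ?thesis by (simp add: real_root_divide)
  qed
  have "(\<lambda>r. real r / root n (real (m n r))) \<longlonglongrightarrow> L"
    by (rule tendsto_sandwich[OF eventually_sequentiallyI[of 2] eventually_sequentiallyI[of 1] lo' hi])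
       (use up down in auto)
  then have "(\<lambda>r. inverse (real r / root n (real (m n r))) ^ n) \<longlonglongrightarrow> inverse L ^ n"
    using Lpos by (intro tendsto_intros) auto
  moreover have "inverse (real r / root n (real (m n r))) ^ n = real (m n r) / real r ^ n" for r
    using assms by (simp add: power_divide)
  ultimately show ?thesis unfolding convergent_def by auto
qed

end
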